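(* Let $\kappa$ be a regular infinite cardinal and let $\mathcal G=\{(a_\alpha,b_\alpha):\alpha<\kappa^+\}$ be a $(\kappa^+,\kappa^+)$ pre-gap in $\mathcal P(\kappa)$. If the group $G(\mathcal U_{\mathcal G})$ is of tightness at most $\kappa$, then $\mathcal G$ is a gap.
   Context: Ordinals are identified with the set of smaller ordinals; $[X]^{<\omega}$ is the set of finite subsets of $X$; $\triangle$ is symmetric difference. A $(\kappa^+,\kappa^+)$ pre-gap in $\mathcal P(\kappa)$ is a family $\mathcal G=\{(a_\alpha,b_\alpha):\alpha<\kappa^+\}$ with $a_\alpha,b_\alpha\subseteq\kappa$ such that (1) $|a_\alpha\setminus a_\beta|<\kappa$ and $|b_\alpha\setminus b_\beta|<\kappa$ for all $\alpha<\beta<\kappa^+$; (2) $a_\alpha\cap b_\alpha=\emptyset$ for each $\alpha<\kappa^+$. It is a gap if there is no $c\subseteq\kappa$ such that $|a_\alpha\setminus c|<\kappa$ and $|b_\alpha\cap c|<\kappa$ for each $\alpha<\kappa^+$. For $\beta<\kappa^+$ and $\xi<\kappa$ let $F^{\mathcal G}_\xi(\beta)=\{\alpha<\beta:a_\alpha\cap b_\beta\subseteq\xi\}$ and $U^{\mathcal G}_\xi(\beta)=\{a\in[\kappa^+]^{<\omega}:a\cap F^{\mathcal G}_\xi(\beta)=\emptyset\}$. Let $\mathcal U_{\mathcal G}=\{\bigcap_{(\xi,\beta)\in K}U^{\mathcal G}_\xi(\beta):K\in[\kappa\times\kappa^+]^{<\omega}\}$. $G(\mathcal U_{\mathcal G})$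 is the topological group $([\kappa^+]^{<\omega},\triangle)$ with the group topology for which $\mathcal U_{\mathcal G}$ is an open neighborhood base at the identity $\emptyset$. A topological group $G$ with identity $e$ has tightness at most $\kappa$ if for every $A\subseteq G$ with $e\in\overline A$ there is $X\subseteq A$ with $|X|\le\kappa$ and $e\in\overline X$. *)

theory Defs
  imports "HOL-Analysis.Abstract_Topology" "HOL-Analysis.Product_Topology" "HOL-Algebra.Group"
begin

unbundle cardinal_syntax

text \<open>
  Cardinals are those of the BNF cardinal library in Main. A cardinal \<open>\<kappa>\<close> is a relation with
  \<open>Card_order \<kappa>\<close>. Its elements (the ordinals below it) are those of \<open>Field \<kappa>\<close>, and an ordinal
  \<open>\<xi>\<close>, viewed as the set of smaller ordinals, is \<open>underS \<kappa> \<xi>\<close>. The successor \<open>\<kappa>\<^sup>+\<close> is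
  \<open>cardSuc \<kappa>\<close>, so \<open>\<alpha> < \<beta> < \<kappa>\<^sup>+\<close> reads \<open>\<beta> \<in> Field (cardSuc \<kappa>)\<close> and
  \<open>\<alpha> \<in> underS (cardSuc \<kappa>) \<beta>\<close>.
\<close>

definition pre_gap :: "'k rel \<Rightarrow> ('k set \<Rightarrow> 'k set) \<Rightarrow> ('k set \<Rightarrow> 'k set) \<Rightarrow> bool" where
  "pre_gap \<kappa> a b \<longleftrightarrow>
     (\<forall>\<alpha>\<in>Field (cardSuc \<kappa>). a \<alpha> \<subseteq> Field \<kappa> \<and> b \<alpha> \<subseteq> Field \<kappa>) \<and>
     (\<forall>\<beta>\<in>Field (cardSuc \<kappa>). \<forall>\<alpha>\<in>underS (cardSuc \<kappa>) \<beta>.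
        |a \<alpha> - a \<beta>| <o \<kappa> \<and> |b \<alpha> - b \<beta>| <o \<kappa>) \<and>
     (\<forall>\<alpha>\<in>Field (cardSuc \<kappa>). a \<alpha> \<inter> b \<alpha> = {})"

definition is_gap :: "'k rel \<Rightarrow> ('k set \<Rightarrow> 'k set) \<Rightarrow> ('k set \<Rightarrow> 'k set) \<Rightarrow> bool" where
  "is_gap \<kappa> a b \<longleftrightarrow> pre_gap \<kappa> a b \<and>
     \<not> (\<exists>c\<subseteq>Field \<kappa>. \<forall>\<alpha>\<in>Field (cardSuc \<kappa>). |a \<alpha> - c| <o \<kappa> \<and> |b \<alpha> \<inter> c| <o \<kappa>)"

definition gap_F :: "'k rel \<Rightarrow> ('k set \<Rightarrow> 'k set) \<Rightarrow> ('k set \<Rightarrow> 'k set) \<Rightarrow> 'k \<Rightarrow> 'k set \<Rightarrow> 'k set set" where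
  "gap_F \<kappa> a b \<xi> \<beta> = {\<alpha> \<in> underS (cardSuc \<kappa>) \<beta>. a \<alpha> \<inter> b \<beta> \<subseteq> underS \<kappa> \<xi>}"

definition gap_U :: "'k rel \<Rightarrow> ('k set \<Rightarrow> 'k set) \<Rightarrow> ('k set \<Rightarrow> 'k set) \<Rightarrow> 'k \<Rightarrow> 'k set \<Rightarrow> 'k set set set" where
  "gap_U \<kappa> a b \<xi> \<beta> = {s \<in> Fpow (Field (cardSuc \<kappa>)). s \<inter> gap_F \<kappa> a b \<xi> \<beta> = {}}"

text \<open>The empty intersection is read as the whole group, hence the intersection with the carrier.\<close>

definition gap_nbhds :: "'k rel \<Rightarrow> ('k set \<Rightarrow> 'k set) \<Rightarrow> ('k set \<Rightarrow> 'k set) \<Rightarrow> 'k set set set set" where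
  "gap_nbhds \<kappa> a b =
     {Fpow (Field (cardSuc \<kappa>)) \<inter> (\<Inter>(\<xi>, \<beta>)\<in>K. gap_U \<kappa> a b \<xi> \<beta>) | K.
        finite K \<and> K \<subseteq> Field \<kappa> \<times> Field (cardSuc \<kappa>)}"

definition finset_group :: "'i set \<Rightarrow> 'i set monoid" where
  "finset_group I = \<lparr>carrier = Fpow I, mult = sym_diff, one = {}\<rparr>"

definition topological_group :: "('g, 'm) monoid_scheme \<Rightarrow> 'g topology \<Rightarrow> bool" where
  "topological_group G T \<longleftrightarrow> group G \<and> topspace T = carrier G \<and>
     continuous_map (prod_topology T T) T (\<lambda>(x, y). x \<otimes>\<^bsub>G\<^esub> y) \<and>
     continuous_map T T (\<lambda>x. inv\<^bsub>G\<^esub> x)"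

definition open_nbhd_base_at :: "'g topology \<Rightarrow> 'g \<Rightarrow> 'g set set \<Rightarrow> bool" where
  "open_nbhd_base_at T x \<U> \<longleftrightarrow> (\<forall>U\<in>\<U>. openin T U \<and> x \<in> U) \<and>
     (\<forall>W. openin T W \<and> x \<in> W \<longrightarrow> (\<exists>U\<in>\<U>. U \<subseteq> W))"

definition group_topology_of :: "('g, 'm) monoid_scheme \<Rightarrow> 'g set set \<Rightarrow> 'g topology" where
  "group_topology_of G \<U> = (THE T. topological_group G T \<and> open_nbhd_base_at T \<one>\<^bsub>G\<^esub> \<U>)"

definition tightness_at_most :: "('g, 'm) monoid_scheme \<Rightarrow> 'g topology \<Rightarrow> 'k rel \<Rightarrow> bool" where
  "tightness_at_most G T \<kappa> \<longleftrightarrow>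
     (\<forall>A\<subseteq>carrier G. \<one>\<^bsub>G\<^esub> \<in> T closure_of A \<longrightarrow>
        (\<exists>X\<subseteq>A. |X| \<le>o \<kappa> \<and> \<one>\<^bsub>G\<^esub> \<in> T closure_of X))"

definition gap_group :: "'k rel \<Rightarrow> 'k set set monoid" where
  "gap_group \<kappa> = finset_group (Field (cardSuc \<kappa>))"

definition gap_topology :: "'k rel \<Rightarrow> ('k set \<Rightarrow> 'k set) \<Rightarrow> ('k set \<Rightarrow> 'k set) \<Rightarrow> 'k set set topology" where
  "gap_topology \<kappa> a b = group_topology_of (gap_group \<kappa>) (gap_nbhds \<kappa> a b)"


text \<open>The topology picked out by the definite description exists and is unique.\<close>

lemma topological_group_openin_iff:
  fixes G (structure)
  assumes T: "topological_group G T" and B: "open_nbhd_base_at T \<one> \<U>"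
  shows "openin T W \<longleftrightarrow> W \<subseteq> carrier G \<and> (\<forall>x\<in>W. \<exists>U\<in>\<U>. \<forall>u\<in>U. x \<otimes> u \<in> W)"
proof -
  interpret group G using T by (simp add: topological_group_def)
  have ts: "topspace T = carrier G"
    and mult: "continuous_map (prod_topology T T) T (\<lambda>(x, y). x \<otimes> y)"
    using T by (auto simp: topological_group_def)
  have trans: "continuous_map T T (\<lambda>y. x \<otimes> y)" if "x \<in> carrier G" for x
  proof -
    have "continuous_map T (prod_topology T T) (\<lambda>y. (x, y))"
      using that ts by (simp add: continuous_map_pairwise o_def)
    from continuous_map_compose[OF this mult] show ?thesis by (simp add: o_def)
  qed
  have pre: "openin T {y \<in> carrier G. x \<otimes> y \<in> W}" if "x \<in> carrier G" "openin T W" for x W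
    using trans[OF that(1)] that(2) ts by (auto simp: continuous_map_def)
  show ?thesis
  proof
    assume W: "openin T W"
    then have sub: "W \<subseteq> carrier G" using openin_subset ts by blast
    have "\<exists>U\<in>\<U>. \<forall>u\<in>U. x \<otimes> u \<in> W" if "x \<in> W" for x
    proof -
      have x: "x \<in> carrier G" using that sub by blast
      then have "\<one> \<in> {y \<in> carrier G. x \<otimes> y \<in> W}" using that by simp
      with pre[OF x W] B obtain U where "U \<in> \<U>" "U \<subseteq> {y \<in> carrier G. x \<otimes> y \<in> W}"
        unfolding open_nbhd_base_at_def by blast
      then show ?thesis by blast
    qed
    with sub show "W \<subseteq> carrier G \<and> (\<forall>x\<in>W. \<exists>U\<in>\<U>. \<forall>u\<in>U. x \<otimes> u \<in> W)" by blast
  next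
    assume W: "W \<subseteq> carrier G \<and> (\<forall>x\<in>W. \<exists>U\<in>\<U>. \<forall>u\<in>U. x \<otimes> u \<in> W)"
    show "openin T W"
    proof (subst openin_subopen, intro ballI)
      fix x assume "x \<in> W"
      with W have x: "x \<in> carrier G" by blast
      from W \<open>x \<in> W\<close> obtain U where U: "U \<in> \<U>" "\<forall>u\<in>U. x \<otimes> u \<in> W" by blast
      with B have oU: "openin T U" "\<one> \<in> U" by (auto simp: open_nbhd_base_at_def)
      let ?V = "{y \<in> carrier G. inv x \<otimes> y \<in> U}"
      have "openin T ?V" using pre[of "inv x" U] x oU by simp
      moreover have "x \<in> ?V" using x oU by simp
      moreover have "?V \<subseteq> W"
      proof
        fix y assume y: "y \<in> ?V"
        then have "x \<otimes> (inv x \<otimes> y) \<in> W" using U by blast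
        then show "y \<in> W" using x y by (simp add: m_assoc[symmetric])
      qed
      ultimately show "\<exists>V. openin T V \<and> x \<in> V \<and> V \<subseteq> W" by blast
    qed
  qed
qed

lemma finset_group_group: "group (finset_group I)"
proof (rule groupI)
  fix x assume "x \<in> carrier (finset_group I)"
  then show "\<exists>y\<in>carrier (finset_group I). y \<otimes>\<^bsub>finset_group I\<^esub> x = \<one>\<^bsub>finset_group I\<^esub>"
    by (auto simp: finset_group_def)
qed (auto simp: finset_group_def Fpow_def)

lemma finset_group_inv:
  assumes "x \<in> Fpow I"
  shows "inv\<^bsub>finset_group I\<^esub> x = x"
proof -
  interpret group "finset_group I" by (rule finset_group_group)
  show ?thesis
    using assms by (intro inv_equality) (auto simp: finset_group_def)
qed

lemma finset_group_topology_exists: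
  assumes "{} \<in> \<S>" and Un: "\<And>S S'. S \<in> \<S> \<Longrightarrow> S' \<in> \<S> \<Longrightarrow> S \<union> S' \<in> \<S>"
  shows "\<exists>T. topological_group (finset_group I) T \<and>
             open_nbhd_base_at T {} {{s \<in> Fpow I. s \<inter> S = {}} | S. S \<in> \<S>}"
proof -
  let ?N = "\<lambda>x S. {y \<in> Fpow I. y \<inter> S = x \<inter> S}"
  let ?P = "\<lambda>W. W \<subseteq> Fpow I \<and> (\<forall>x\<in>W. \<exists>S\<in>\<S>. ?N x S \<subseteq> W)"
  define T where "T = topology ?P"
  have "istopology ?P"
    unfolding istopology_def
  proof (intro conjI allI impI)
    fix W W' assume W: "?P W" and W': "?P W'"
    show "W \<inter> W' \<subseteq> Fpow I" using W by blast
    show "\<forall>x\<in>W \<inter> W'. \<exists>S\<in>\<S>. ?N x S \<subseteq> W \<inter> W'"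
    proof
      fix x assume "x \<in> W \<inter> W'"
      then have x: "x \<in> W" "x \<in> W'" by simp_all
      obtain S where "S \<in> \<S>" "?N x S \<subseteq> W" using bspec[OF conjunct2[OF W] x(1)] by (elim bexE)
      moreover obtain S' where "S' \<in> \<S>" "?N x S' \<subseteq> W'"
        using bspec[OF conjunct2[OF W'] x(2)] by (elim bexE)
      ultimately have S: "S \<in> \<S>" "?N x S \<subseteq> W" "S' \<in> \<S>" "?N x S' \<subseteq> W'" by simp_all
      have "?N x (S \<union> S') \<subseteq> ?N x S \<inter> ?N x S'" by blast
      also have "\<dots> \<subseteq> W \<inter> W'" by (rule Int_mono[OF S(2) S(4)])
      finally show "\<exists>S\<in>\<S>. ?N x S \<subseteq> W \<inter> W'" by (rule bexI[OF _ Un[OF S(1) S(3)]])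
    qed
  next
    fix \<K> assume K: "\<forall>W\<in>\<K>. ?P W"
    show "\<Union> \<K> \<subseteq> Fpow I" using K by blast
    show "\<forall>x\<in>\<Union> \<K>. \<exists>S\<in>\<S>. ?N x S \<subseteq> \<Union> \<K>"
    proof
      fix x assume "x \<in> \<Union> \<K>"
      then obtain W where W: "W \<in> \<K>" "x \<in> W" by blast
      obtain S where "S \<in> \<S>" "?N x S \<subseteq> W"
        using bspec[OF conjunct2[OF bspec[OF K W(1)]] W(2)] by (elim bexE)
      moreover have "W \<subseteq> \<Union> \<K>" using W(1) by (rule Union_upper)
      ultimately show "\<exists>S\<in>\<S>. ?N x S \<subseteq> \<Union> \<K>" by (meson order_trans)
    qed
  qed
  then have op: "openin T W \<longleftrightarrow> ?P W" for W
    by (simp add: T_def topology_inverse')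
  have N: "openin T (?N x S)" if "S \<in> \<S>" for x S
    using that by (auto simp: op)
  have ts: "topspace T = Fpow I"
  proof
    show "topspace T \<subseteq> Fpow I" using op by (auto simp: topspace_def)
    have "openin T (Fpow I)" using assms(1) by (auto simp: op)
    then show "Fpow I \<subseteq> topspace T" by (rule openin_subset)
  qed
  have cl: "sym_diff x y \<in> Fpow I" if "x \<in> Fpow I" "y \<in> Fpow I" for x y
    using that by (auto simp: Fpow_def)
  have "continuous_map (prod_topology T T) T (\<lambda>(x, y). sym_diff x y)"
    unfolding continuous_map_def
  proof (intro conjI allI impI)
    show "(\<lambda>(x, y). sym_diff x y) \<in> topspace (prod_topology T T) \<rightarrow> topspace T"
    proof (rule Pi_I)
      fix p assume "p \<in> topspace (prod_topology T T)"
      then have "fst p \<in> Fpow I" "snd p \<in> Fpow I" by (simp_all add: ts mem_Times_iff)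
      then show "(case p of (x, y) \<Rightarrow> sym_diff x y) \<in> topspace T"
        unfolding case_prod_beta ts by (rule cl)
    qed
    fix W assume W: "openin T W"
    let ?Q = "{p \<in> topspace (prod_topology T T). (case p of (x, y) \<Rightarrow> sym_diff x y) \<in> W}"
    show "openin (prod_topology T T) ?Q"
    proof (subst openin_subopen, intro ballI)
      fix p assume "p \<in> ?Q"
      then obtain x y where p: "p = (x, y)" "x \<in> Fpow I" "y \<in> Fpow I" "sym_diff x y \<in> W"
        by (auto simp: ts)
      obtain S where S: "S \<in> \<S>" "?N (sym_diff x y) S \<subseteq> W"
        using bspec[OF conjunct2[OF W[unfolded op]] p(4)] by (elim bexE)
      have "openin (prod_topology T T) (?N x S \<times> ?N y S)"
        using N S by (simp add: openin_prod_Times_iff)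
      moreover have "p \<in> ?N x S \<times> ?N y S" using p by simp
      moreover have "?N x S \<times> ?N y S \<subseteq> ?Q"
      proof clarify
        fix x' y' assume *: "x' \<in> Fpow I" "x' \<inter> S = x \<inter> S" "y' \<in> Fpow I" "y' \<inter> S = y \<inter> S"
        then have "sym_diff x' y' \<inter> S = sym_diff x y \<inter> S" by blast
        then have "sym_diff x' y' \<in> W" using S cl * by blast
        with * show "(x', y') \<in> topspace (prod_topology T T) \<and> sym_diff x' y' \<in> W" by (simp add: ts)
      qed
      ultimately show "\<exists>V. openin (prod_topology T T) V \<and> p \<in> V \<and> V \<subseteq> ?Q" by blast
    qed
  qed
  moreover have "continuous_map T T (\<lambda>x. inv\<^bsub>finset_group I\<^esub> x)"
    by (rule continuous_map_eq[OF continuous_map_id]) (simp add: ts finset_group_inv)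
  ultimately have "topological_group (finset_group I) T"
    using finset_group_group[of I] by (simp add: topological_group_def ts finset_group_def)
  moreover have "open_nbhd_base_at T {} {{s \<in> Fpow I. s \<inter> S = {}} | S. S \<in> \<S>}"
  proof -
    have "openin T {s \<in> Fpow I. s \<inter> S = {}}" if "S \<in> \<S>" for S
      using N[OF that, of "{}"] by simp
    moreover have "\<exists>U\<in>{{s \<in> Fpow I. s \<inter> S = {}} | S. S \<in> \<S>}. U \<subseteq> W" if W: "openin T W" "{} \<in> W" for W
    proof -
      obtain S where "S \<in> \<S>" "?N {} S \<subseteq> W"
        using bspec[OF conjunct2[OF W(1)[unfolded op]] W(2)] by (elim bexE)
      then show ?thesis by (intro bexI[of _ "{s \<in> Fpow I. s \<inter> S = {}}"] CollectI exI[of _ S]) simp_all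
    qed
    ultimately show ?thesis
      unfolding open_nbhd_base_at_def
      by (intro conjI allI impI ballI) (elim CollectE exE conjE; simp add: empty_in_Fpow)+
  qed
  ultimately show ?thesis by blast
qed

lemma gap_nbhds_eq:
  "gap_nbhds \<kappa> a b =
     {{s \<in> Fpow (Field (cardSuc \<kappa>)). s \<inter> S = {}} | S.
        S \<in> {\<Union>(\<xi>, \<beta>)\<in>K. gap_F \<kappa> a b \<xi> \<beta> | K. finite K \<and> K \<subseteq> Field \<kappa> \<times> Field (cardSuc \<kappa>)}}"
proof -
  have "Fpow (Field (cardSuc \<kappa>)) \<inter> (\<Inter>(\<xi>, \<beta>)\<in>K. gap_U \<kappa> a b \<xi> \<beta>)
      = {s \<in> Fpow (Field (cardSuc \<kappa>)). s \<inter> (\<Union>(\<xi>, \<beta>)\<in>K. gap_F \<kappa> a b \<xi> \<beta>) = {}}" for K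
  proof (rule Set.set_eqI)
    fix s
    show "s \<in> Fpow (Field (cardSuc \<kappa>)) \<inter> (\<Inter>(\<xi>, \<beta>)\<in>K. gap_U \<kappa> a b \<xi> \<beta>) \<longleftrightarrow>
        s \<in> {s \<in> Fpow (Field (cardSuc \<kappa>)). s \<inter> (\<Union>(\<xi>, \<beta>)\<in>K. gap_F \<kappa> a b \<xi> \<beta>) = {}}"
      by (cases "s \<in> Fpow (Field (cardSuc \<kappa>))")
        (auto simp: gap_U_def)
  qed
  then show ?thesis unfolding gap_nbhds_def by (simp add: setcompr_eq_image image_image)
qed

lemma gap_topology_ex1:
  "\<exists>!T. topological_group (gap_group \<kappa>) T \<and>
        open_nbhd_base_at T \<one>\<^bsub>gap_group \<kappa>\<^esub> (gap_nbhds \<kappa> a b)"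
proof (rule ex_ex1I)
  let ?S = "{\<Union>(\<xi>, \<beta>)\<in>K. gap_F \<kappa> a b \<xi> \<beta> | K. finite K \<and> K \<subseteq> Field \<kappa> \<times> Field (cardSuc \<kappa>)}"
  have "\<exists>T. topological_group (finset_group (Field (cardSuc \<kappa>))) T \<and>
      open_nbhd_base_at T {} {{s \<in> Fpow (Field (cardSuc \<kappa>)). s \<inter> S = {}} | S. S \<in> ?S}"
  proof (rule finset_group_topology_exists)
    show "{} \<in> ?S" by (rule CollectI, rule exI[of _ "{}"]) simp
    fix S S' assume "S \<in> ?S" "S' \<in> ?S"
    then obtain K K' where "S = (\<Union>(\<xi>, \<beta>)\<in>K. gap_F \<kappa> a b \<xi> \<beta>)" "S' = (\<Union>(\<xi>, \<beta>)\<in>K'. gap_F \<kappa> a b \<xi> \<beta>)"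
      "finite K" "finite K'" "K \<subseteq> Field \<kappa> \<times> Field (cardSuc \<kappa>)" "K' \<subseteq> Field \<kappa> \<times> Field (cardSuc \<kappa>)"
      by blast
    then show "S \<union> S' \<in> ?S" by (intro CollectI exI[of _ "K \<union> K'"]) auto
  qed
  then show "\<exists>T. topological_group (gap_group \<kappa>) T \<and>
      open_nbhd_base_at T \<one>\<^bsub>gap_group \<kappa>\<^esub> (gap_nbhds \<kappa> a b)"
    by (simp add: gap_nbhds_eq gap_group_def finset_group_def)
next
  fix T T'
  assume *: "topological_group (gap_group \<kappa>) T \<and> open_nbhd_base_at T \<one>\<^bsub>gap_group \<kappa>\<^esub> (gap_nbhds \<kappa> a b)"
    and **: "topological_group (gap_group \<kappa>) T' \<and> open_nbhd_base_at T' \<one>\<^bsub>gap_group \<kappa>\<^esub> (gap_nbhds \<kappa> a b)"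
  show "T = T'"
    unfolding topology_eq
    by (simp only: topological_group_openin_iff[OF conjunct1[OF *] conjunct2[OF *]]
        topological_group_openin_iff[OF conjunct1[OF **] conjunct2[OF **]] simp_thms)
qed

lemma gap_topology:
  "topological_group (gap_group \<kappa>) (gap_topology \<kappa> a b)"
  "open_nbhd_base_at (gap_topology \<kappa> a b) \<one>\<^bsub>gap_group \<kappa>\<^esub> (gap_nbhds \<kappa> a b)"
  using theI'[OF gap_topology_ex1[of \<kappa> a b]]
  by (simp_all add: gap_topology_def group_topology_of_def)

end

theory Submission
  imports Defs
begin

text \<open>
  If \<open>c\<close> separates the pre-gap, then by regularity some \<open>\<xi> < \<kappa>\<close> bounds both \<open>a\<^sub>\<alpha> - c\<close> and
  \<open>b\<^sub>\<alpha> \<inter> c\<close> for all \<open>\<alpha>\<close> in a set \<open>Y\<close> of size \<open>\<kappa>\<^sup>+\<close>; hence \<open>\<alpha> \<in> F\<^sub>\<xi>(\<beta>)\<close> whenever \<open>\<alpha> < \<beta>\<close> are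
  in \<open>Y\<close>. The identity is in the closure of the singletons \<open>{\<alpha>}\<close>, \<open>\<alpha> \<in> Y\<close>, because every
  \<open>F\<^sub>\<eta>(\<beta>)\<close> is bounded, but at most \<open>\<kappa>\<close> of these singletons lie below some \<open>\<beta> \<in> Y\<close> and are
  therefore all missed by the neighbourhood \<open>U\<^sub>\<xi>(\<beta>)\<close>.
\<close>

text \<open>By regularity a cofinal set has the full size of \<open>r\<close>, so \<open>S\<close>
  is not cofinal. As \<open>cofinal\<close> asks for strictly larger elements, this only gives a
  weak upper bound \<open>y\<close>; since \<open>r\<close> has no largest element, some
  \<open>x\<close> above \<open>y\<close> is a strict one.\<close>

lemma regularCard_bounded:
  assumes "Card_order r" "infinite (Field r)" "regularCard r" "S \<subseteq> Field r" "|S| <o r"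
  obtains x where "x \<in> Field r" "S \<subseteq> underS r x"
proof -
  have wo: "wo_rel r"
    using assms(1) by (simp add: card_order_on_well_order_on wo_rel_def)
  have "\<not> cofinal S r"
    using assms(3-5) not_ordLess_ordIso unfolding regularCard_def by blast
  then obtain y where y: "y \<in> Field r" "\<forall>s\<in>S. y = s \<or> (y, s) \<notin> r"
    unfolding cofinal_def by blast
  obtain x where x: "x \<in> Field r" "y \<noteq> x" "(y, x) \<in> r"
    using infinite_Card_order_limit[OF assms(1,2) y(1)] by blast
  have "s \<in> underS r x" if "s \<in> S" for s
  proof -
    have "(s, y) \<in> r"
      using that y assms(4) wo_rel.in_notinI[OF wo] by blast
    then show ?thesis
      using x wo_rel.TRANS[OF wo] wo_rel.ANTISYM[OF wo] unfolding underS_def trans_def antisym_def by blast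
  qed
  with x(1) that show thesis by blast
qed

text \<open>The closed segment below \<open>x\<close> lies in the open segment below some larger
  \<open>y\<close>, which is smaller than \<open>cardSuc r\<close>, hence of size at most
  \<open>r\<close>.\<close>

lemma card_of_under_cardSuc:
  assumes "Card_order r" "infinite (Field r)" "x \<in> Field (cardSuc r)"
  shows "|under (cardSuc r) x| \<le>o r"
proof -
  have co: "Card_order (cardSuc r)" and inf: "infinite (Field (cardSuc r))"
    using assms(1,2) by (simp_all add: cardSuc_Card_order cardSuc_finite)
  have wo: "wo_rel (cardSuc r)"
    using co by (simp add: card_order_on_well_order_on wo_rel_def)
  obtain y where y: "y \<in> Field (cardSuc r)" "x \<noteq> y" "(x, y) \<in> cardSuc r"
    using infinite_Card_order_limit[OF co inf assms(3)] by blast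
  have "under (cardSuc r) x \<subseteq> underS (cardSuc r) y"
    using y wo_rel.TRANS[OF wo] wo_rel.ANTISYM[OF wo] unfolding underS_def under_def trans_def antisym_def by blast
  then have "|under (cardSuc r) x| <o cardSuc r"
    using card_of_mono1 card_of_underS[OF co y(1)] ordLeq_ordLess_trans by blast
  then show ?thesis
    using assms(1) cardSuc_ordLeq_ordLess card_of_Card_order by blast
qed

text \<open>The closed segments below the points of \<open>X\<close> together have size at most
  \<open>r\<close>, so they cannot cover \<open>Y\<close>; a point of \<open>Y\<close> that they
  miss is above all of \<open>X\<close> by totality.\<close>

lemma exists_strict_upper_bound_cardSuc:
  assumes r: "Card_order r" "infinite (Field r)"
    and Y: "Y \<subseteq> Field (cardSuc r)" "\<not> |Y| \<le>o r"
    and X: "X \<subseteq> Field (cardSuc r)" "|X| \<le>o r"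
  obtains y where "y \<in> Y" "X \<subseteq> underS (cardSuc r) y"
proof -
  have wo: "wo_rel (cardSuc r)"
    using cardSuc_Card_order[OF r(1)] by (simp add: card_order_on_well_order_on wo_rel_def)
  have "|\<Union>x\<in>X. under (cardSuc r) x| \<le>o r"
    using card_of_UNION_ordLeq_infinite_Field[OF r(2,1) X(2)] card_of_under_cardSuc[OF r] X(1)
    by blast
  then have "\<not> Y \<subseteq> (\<Union>x\<in>X. under (cardSuc r) x)"
    using Y(2) card_of_mono1 ordLeq_transitive by blast
  then obtain y where y: "y \<in> Y" "\<forall>x\<in>X. (y, x) \<notin> cardSuc r"
    unfolding under_def by blast
  have "x \<in> underS (cardSuc r) y" if "x \<in> X" for x
  proof -
    have "x \<in> Field (cardSuc r)" "y \<in> Field (cardSuc r)" "(y, x) \<notin> cardSuc r"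
      using that y X(1) Y(1) by blast+
    then show ?thesis
      using wo_rel.TOTALS[OF wo] unfolding underS_def by blast
  qed
  with y(1) that show thesis by blast
qed

theorem theorem7p4:
  fixes \<kappa> :: "'k rel" and a b :: "'k set \<Rightarrow> 'k set"
  assumes "Card_order \<kappa>" and "infinite (Field \<kappa>)" and "regularCard \<kappa>"
    and "pre_gap \<kappa> a b"
    and "tightness_at_most (gap_group \<kappa>) (gap_topology \<kappa> a b) \<kappa>"
  shows "is_gap \<kappa> a b"
proof (rule ccontr)
  let ?I = "Field (cardSuc \<kappa>)" and ?T = "gap_topology \<kappa> a b"
  have carr: "carrier (gap_group \<kappa>) = Fpow ?I" and one: "\<one>\<^bsub>gap_group \<kappa>\<^esub> = {}"
    by (simp_all add: gap_group_def finset_group_def)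
  have ts: "topspace ?T = Fpow ?I"
    using gap_topology(1)[of \<kappa> a b] carr by (simp add: topological_group_def)
  have base: "open_nbhd_base_at ?T {} (gap_nbhds \<kappa> a b)"
    using gap_topology(2)[of \<kappa> a b] one by simp
  assume "\<not> is_gap \<kappa> a b"
  then obtain c where c: "\<And>\<alpha>. \<alpha> \<in> ?I \<Longrightarrow> |a \<alpha> - c| <o \<kappa> \<and> |b \<alpha> \<inter> c| <o \<kappa>"
    using assms(4) unfolding is_gap_def by blast
  define Y where "Y \<xi> = {\<alpha> \<in> ?I. (a \<alpha> - c) \<union> (b \<alpha> \<inter> c) \<subseteq> underS \<kappa> \<xi>}" for \<xi>
  have "\<exists>\<xi>\<in>Field \<kappa>. \<alpha> \<in> Y \<xi>" if \<alpha>: "\<alpha> \<in> ?I" for \<alpha>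
  proof -
    have "|(a \<alpha> - c) \<union> (b \<alpha> \<inter> c)| <o \<kappa>"
      using c[OF \<alpha>] card_of_Un_ordLess_infinite_Field[OF assms(2,1)] by blast
    moreover have "(a \<alpha> - c) \<union> (b \<alpha> \<inter> c) \<subseteq> Field \<kappa>"
      using assms(4) \<alpha> unfolding pre_gap_def by blast
    ultimately obtain \<xi> where "\<xi> \<in> Field \<kappa>" "(a \<alpha> - c) \<union> (b \<alpha> \<inter> c) \<subseteq> underS \<kappa> \<xi>"
      using regularCard_bounded[OF assms(1-3)] by blast
    with \<alpha> show ?thesis unfolding Y_def by blast
  qed
  then have cover: "?I \<subseteq> (\<Union>\<xi>\<in>Field \<kappa>. Y \<xi>)" by blast
  \<comment> \<open>Pigeonhole: otherwise \<open>cardSuc \<kappa>\<close> would be covered by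
    \<kappa> sets of size at most \<kappa>.\<close>
  obtain \<xi> where \<xi>: "\<xi> \<in> Field \<kappa>" and large: "\<not> |Y \<xi>| \<le>o \<kappa>"
  proof (rule ccontr)
    assume "\<not> thesis"
    then have "\<forall>\<xi>\<in>Field \<kappa>. |Y \<xi>| \<le>o \<kappa>" using that by blast
    moreover have "|Field \<kappa>| \<le>o \<kappa>"
      using assms(1) card_of_Field_ordIso ordIso_iff_ordLeq by blast
    ultimately have "|\<Union>\<xi>\<in>Field \<kappa>. Y \<xi>| \<le>o \<kappa>"
      using card_of_UNION_ordLeq_infinite_Field[OF assms(2,1)] by blast
    with cover have "|?I| \<le>o \<kappa>"
      using card_of_mono1 ordLeq_transitive by blast
    then have "cardSuc \<kappa> \<le>o \<kappa>"
      using card_of_Field_ordIso[OF cardSuc_Card_order[OF assms(1)]]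
        ordIso_symmetric ordIso_ordLeq_trans by blast
    then show False
      using cardSuc_greater[OF assms(1)] not_ordLess_ordLeq by blast
  qed
  have YI: "Y \<xi> \<subseteq> ?I" unfolding Y_def by blast
  note bound = exists_strict_upper_bound_cardSuc[OF assms(1,2) YI large]
  define A where "A = (\<lambda>\<alpha>. {\<alpha>}) ` Y \<xi>"
  have A: "A \<subseteq> Fpow ?I" using YI unfolding A_def Fpow_def by blast
  have "{} \<in> ?T closure_of A"
    unfolding in_closure_of
  proof (intro conjI allI impI)
    show "{} \<in> topspace ?T" by (simp add: ts empty_in_Fpow)
    fix W assume "{} \<in> W \<and> openin ?T W"
    then obtain U where U: "U \<in> gap_nbhds \<kappa> a b" "U \<subseteq> W"
      using base unfolding open_nbhd_base_at_def by blast
    then obtain K where K: "finite K" "K \<subseteq> Field \<kappa> \<times> ?I"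
      "U = Fpow ?I \<inter> (\<Inter>(\<eta>, \<beta>)\<in>K. gap_U \<kappa> a b \<eta> \<beta>)"
      unfolding gap_nbhds_def by blast
    \<comment> \<open>Choose \<alpha> in \<open>Y \<xi>\<close> above every \<beta> occurring in
      \<open>K\<close>. Since \<open>gap_F \<kappa> a b \<eta> \<beta>\<close> contains only
      ordinals below \<beta>, \<open>{\<alpha>}\<close> misses all these sets.\<close>
    have "|snd ` K| \<le>o \<kappa>"
      using K(1) assms(1,2) finite_ordLess_infinite[of "|snd ` K|" \<kappa>] ordLess_imp_ordLeq
      by (auto simp: Field_card_of card_of_well_order_on card_order_on_well_order_on)
    moreover have "snd ` K \<subseteq> ?I" using K(2) by auto
    ultimately obtain \<alpha> where \<alpha>: "\<alpha> \<in> Y \<xi>" "snd ` K \<subseteq> underS (cardSuc \<kappa>) \<alpha>"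
      using bound by blast
    have "{\<alpha>} \<in> gap_U \<kappa> a b \<eta> \<beta>" if "(\<eta>, \<beta>) \<in> K" for \<eta> \<beta>
    proof -
      have "\<beta> \<in> underS (cardSuc \<kappa>) \<alpha>" using \<alpha>(2) that by force
      moreover have "antisym (cardSuc \<kappa>)"
        using wo_rel.ANTISYM[of "cardSuc \<kappa>"] cardSuc_Card_order[OF assms(1)]
        by (simp add: card_order_on_well_order_on wo_rel_def)
      ultimately have "\<alpha> \<notin> underS (cardSuc \<kappa>) \<beta>"
        unfolding underS_def antisym_def by blast
      then show ?thesis
        using \<alpha>(1) YI unfolding gap_U_def gap_F_def Fpow_def by auto
    qed
    then have "{\<alpha>} \<in> U"
      using K(3) \<alpha>(1) YI by (auto simp: Fpow_def)
    with U(2) \<alpha>(1) show "\<exists>y. y \<in> A \<and> y \<in> W" unfolding A_def by blast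
  qed
  then obtain X where X: "X \<subseteq> A" "|X| \<le>o \<kappa>" "{} \<in> ?T closure_of X"
    using assms(5) A unfolding tightness_at_most_def carr one by blast
  have "\<Union>X \<subseteq> ?I" using X(1) A unfolding Fpow_def by blast
  moreover have "|\<Union>X| \<le>o \<kappa>"
  proof -
    \<comment> \<open>All members of \<open>X\<close> are singletons, so its union is an image of
      \<open>X\<close>.\<close>
    have "\<Union>X = the_elem ` X" using X(1) unfolding A_def by force
    then show ?thesis using card_of_image X(2) ordLeq_transitive by metis
  qed
  ultimately obtain \<beta> where \<beta>: "\<beta> \<in> Y \<xi>" "\<Union>X \<subseteq> underS (cardSuc \<kappa>) \<beta>"
    using bound by blast
  \<comment> \<open>Split \<open>a \<alpha> \<inter> b \<beta>\<close> along \<open>c\<close>: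
    points outside \<open>c\<close> lie in \<open>a \<alpha> - c\<close>, points inside in
    \<open>b \<beta> \<inter> c\<close>. Both sets are below \<xi>, as \<alpha> and \<beta> are in
    \<open>Y \<xi>\<close>.\<close>
  have "\<alpha> \<in> gap_F \<kappa> a b \<xi> \<beta>" if "{\<alpha>} \<in> X" for \<alpha>
  proof -
    have "\<alpha> \<in> Y \<xi>" "\<alpha> \<in> underS (cardSuc \<kappa>) \<beta>"
      using that X(1) \<beta>(2) unfolding A_def by blast+
    then show ?thesis using \<beta>(1) unfolding Y_def gap_F_def by blast
  qed
  then have disj: "X \<inter> gap_U \<kappa> a b \<xi> \<beta> = {}"
    using X(1) unfolding A_def gap_U_def by blast
  \<comment> \<open>Taking \<open>K = {(\<xi>, \<beta>)}\<close> shows that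
    \<open>gap_U \<kappa> a b \<xi> \<beta>\<close> is itself a basic neighbourhood of the identity;
    it is disjoint from \<open>X\<close>, although the identity is in the closure of
    \<open>X\<close>.\<close>
  have "Fpow ?I \<inter> (\<Inter>(\<eta>, \<gamma>)\<in>{(\<xi>, \<beta>)}. gap_U \<kappa> a b \<eta> \<gamma>) \<in> gap_nbhds \<kappa> a b"
    using \<xi> \<beta>(1) YI unfolding gap_nbhds_def by blast
  moreover have "Fpow ?I \<inter> (\<Inter>(\<eta>, \<gamma>)\<in>{(\<xi>, \<beta>)}. gap_U \<kappa> a b \<eta> \<gamma>) = gap_U \<kappa> a b \<xi> \<beta>"
    unfolding gap_U_def by auto
  ultimately have "openin ?T (gap_U \<kappa> a b \<xi> \<beta>)" "{} \<in> gap_U \<kappa> a b \<xi> \<beta>"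
    using base unfolding open_nbhd_base_at_def by auto
  with X(3) disj show False unfolding in_closure_of by blast
qed

end
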